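(* Let $C=(c_{ij})$ be an $n\times n$ nonnegative matrix with row-sums $r_1\ge r_2\ge\cdots\ge r_n$, and let $1\le t<n$. Let $d=\max_{t<i\le n}c_{ii}$ and $f=\max_{1\le i\le n,\ t<j\le n,\ i\ne j}c_{ij}$. Assume that $$0<r_n-(n-t-1)f-d\le r_t-(n-t)f.$$ Then $$\rho(C)\ge\frac{r_t-f+d+\sqrt{(r_t-(2n-2t-1)f-d)^2+4(n-t)f\,(r_n-(n-t-1)f-d)}}{2}.$$ Moreover, if $C$ is irreducible and $f>0$, then equality holds if and only if $r_1=r_n$ or both of the following hold: (a) $r_1=r_t$ and $r_{t+1}=r_n$; (b) $\sum_{j=1}^{t}c_{ij}=r_t-(n-t)f$ for all $1\le i\le t$, and $\sum_{j=1}^{t}c_{ij}=r_n-(n-t-1)f-d$ for all $t<i\le n$.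
   Context: All matrices are real. $\rho(C)$ is the spectral radius of $C$. The row-sums of $C$ are $r_i=\sum_{j=1}^n c_{ij}$. *)

theory Defs
  imports
    "Jordan_Normal_Form.Spectral_Radius"
    "HOL-Combinatorics.Permutations"
begin

(* Matrix entries are indexed from 0: the entry c_{ij} is C $$ (i - 1, j - 1). *)

definition nonneg_mat :: "real mat \<Rightarrow> bool" where
  "nonneg_mat C \<longleftrightarrow> (\<forall>i < dim_row C. \<forall>j < dim_col C. 0 \<le> C $$ (i, j))"

definition row_sum :: "real mat \<Rightarrow> nat \<Rightarrow> real" where
  "row_sum C i = (\<Sum>j < dim_col C. C $$ (i, j))"

definition real_spectral_radius :: "real mat \<Rightarrow> real" where
  "real_spectral_radius C = spectral_radius (map_mat complex_of_real C)"

(* C is reducible if a simultaneous permutation of rows and columns brings it to block upper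
   triangular form with square diagonal blocks of positive sizes k and dim_row C - k. *)
definition reducible_mat :: "real mat \<Rightarrow> bool" where
  "reducible_mat C \<longleftrightarrow>
     (\<exists>p k. p permutes {..<dim_row C} \<and> 0 < k \<and> k < dim_row C \<and>
        (\<forall>i \<in> {k..<dim_row C}. \<forall>j < k. C $$ (p i, p j) = 0))"

(* Under this convention every 1 x 1 matrix, including the zero one, is irreducible. *)
definition irreducible_mat :: "real mat \<Rightarrow> bool" where
  "irreducible_mat C \<longleftrightarrow> square_mat C \<and> \<not> reducible_mat C"

end

theory Submission
  imports Defs
begin

text \<open>Put \<open>m = n - t\<close>, \<open>g = m f\<close>, \<open>c = (m - 1) f + d\<close>, \<open>b = r\<^sub>t - g\<close>, \<open>a = r\<^sub>n - c\<close>. The bound is the larger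
  eigenvalue \<open>\<lambda>\<close> of the \<open>2 \<times> 2\<close> matrix with rows \<open>(b, g)\<close> and \<open>(a, c)\<close>, which has an eigenvector \<open>(s, 1)\<close>
  with \<open>s \<ge> 1\<close>. Blowing it up to \<open>x = (s, \<dots>, s, 1, \<dots>, 1)\<close> gives \<open>C x \<ge> \<lambda> x\<close>, because in each row the
  columns beyond \<open>t\<close> carry at most \<open>g\<close> respectively \<open>c\<close>. A positive subinvariant vector yields
  \<open>\<lambda> \<le> \<rho>(C)\<close>, since powers of a matrix with spectral radius below one are bounded. For irreducible \<open>C\<close>
  equality forces \<open>C x = \<lambda> x\<close>, and the row-wise defects of \<open>C x \<ge> \<lambda> x\<close> are sums of two nonnegative terms
  whose vanishing is the stated condition; the alternative \<open>r\<^sub>1 = r\<^sub>n\<close> is the case \<open>s = 1\<close>.\<close>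

section \<open>Matrix-vector products and eigenvectors in coordinates\<close>

lemma mult_mat_vec_index_sum:
  assumes "A \<in> carrier_mat n n" "v \<in> carrier_vec n" "i < n"
  shows "(A *\<^sub>v v) $ i = (\<Sum>j<n. A $$ (i, j) * v $ j)"
  using assms by (auto simp: mult_mat_vec_def scalar_prod_def lessThan_atLeast0)

lemma eigenvector_row:
  assumes "A \<in> carrier_mat n n" "eigenvector A v k" "i < n"
  shows "(\<Sum>j<n. A $$ (i, j) * v $ j) = k * v $ i"
proof -
  from assms have v: "v \<in> carrier_vec n" "A *\<^sub>v v = k \<cdot>\<^sub>v v"
    by (auto simp: eigenvector_def)
  show ?thesis
    using mult_mat_vec_index_sum[OF assms(1) v(1) assms(3)] v assms(3) by simp
qed

lemma eigenvectorI_rows: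
  assumes "A \<in> carrier_mat n n" "v \<in> carrier_vec n" "v \<noteq> 0\<^sub>v n"
    and "\<And>i. i < n \<Longrightarrow> (\<Sum>j<n. A $$ (i, j) * v $ j) = k * v $ i"
  shows "eigenvector A v k"
proof -
  have "A *\<^sub>v v = k \<cdot>\<^sub>v v"
  proof (rule eq_vecI)
    fix i assume "i < dim_vec (k \<cdot>\<^sub>v v)"
    then have "i < n" using assms by simp
    then show "(A *\<^sub>v v) $ i = (k \<cdot>\<^sub>v v) $ i"
      using mult_mat_vec_index_sum[OF assms(1,2)] assms by simp
  qed (use assms in auto)
  then show ?thesis using assms by (auto simp: eigenvector_def)
qed

section \<open>Powers of nonnegative matrices\<close>

lemma nonneg_mat_power:
  assumes "D \<in> carrier_mat n n" "nonneg_mat D" "i < n" "j < n"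
  shows "0 \<le> (D ^\<^sub>m k) $$ (i, j)"
  using assms(3,4)
proof (induction k arbitrary: i j)
  case 0
  then show ?case using assms(1) by auto
next
  case (Suc k)
  have "(D ^\<^sub>m Suc k) $$ (i, j) = (\<Sum>l<n. (D ^\<^sub>m k) $$ (i, l) * D $$ (l, j))"
    using Suc.prems assms(1) by (auto simp: scalar_prod_def lessThan_atLeast0)
  also have "\<dots> \<ge> 0"
    using Suc assms by (intro sum_nonneg mult_nonneg_nonneg) (auto simp: nonneg_mat_def)
  finally show ?case .
qed

text \<open>Nonnegativity of \<open>D ^\<^sub>m k\<close> allows the one-step inequality to be
  inserted under the sum, so each further power gains a factor \<open>q\<close>.\<close>

lemma subinvariant_power:
  fixes q :: real
  assumes D: "D \<in> carrier_mat n n" "nonneg_mat D" and q: "0 \<le> q"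
    and sub: "\<And>i. i < n \<Longrightarrow> q * x i \<le> (\<Sum>j<n. D $$ (i, j) * x j)"
    and "i < n"
  shows "q ^ k * x i \<le> (\<Sum>j<n. (D ^\<^sub>m k) $$ (i, j) * x j)"
proof (induction k)
  case 0
  have "(\<Sum>j<n. (1\<^sub>m n) $$ (i, j) * x j) = (\<Sum>j<n. if i = j then x j else 0)"
    using \<open>i < n\<close> by (intro sum.cong) auto
  then show ?case using D \<open>i < n\<close> by (simp add: carrier_matD)
next
  case (Suc k)
  have "q ^ Suc k * x i \<le> q * (\<Sum>l<n. (D ^\<^sub>m k) $$ (i, l) * x l)"
    using mult_left_mono[OF Suc q] by (simp add: mult.assoc)
  also have "\<dots> = (\<Sum>l<n. (D ^\<^sub>m k) $$ (i, l) * (q * x l))"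
    by (simp add: sum_distrib_left mult_ac)
  also have "\<dots> \<le> (\<Sum>l<n. (D ^\<^sub>m k) $$ (i, l) * (\<Sum>j<n. D $$ (l, j) * x j))"
    using sub nonneg_mat_power[OF D \<open>i < n\<close>] by (intro sum_mono mult_left_mono) auto
  also have "\<dots> = (\<Sum>l<n. \<Sum>j<n. (D ^\<^sub>m k) $$ (i, l) * D $$ (l, j) * x j)"
    by (simp add: sum_distrib_left mult.assoc)
  also have "\<dots> = (\<Sum>j<n. \<Sum>l<n. (D ^\<^sub>m k) $$ (i, l) * D $$ (l, j) * x j)"
    by (rule sum.swap)
  also have "\<dots> = (\<Sum>j<n. (D ^\<^sub>m Suc k) $$ (i, j) * x j)"
    using D \<open>i < n\<close>
    by (intro sum.cong) (auto simp: scalar_prod_def lessThan_atLeast0 sum_distrib_right)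
  finally show ?case .
qed

section \<open>Spectral radius estimates from positive vectors\<close>

lemma real_spectral_radius_eigenvalue:
  assumes C: "C \<in> carrier_mat n n" and n: "0 < n"
  obtains v e where "eigenvector (map_mat complex_of_real C) v e"
    "cmod e = real_spectral_radius C"
proof -
  have "map_mat complex_of_real C \<in> carrier_mat n n" using C by simp
  from spectral_radius_mem_max(1)[OF this n] show ?thesis
    using that by (auto simp: spectrum_def eigenvalue_def real_spectral_radius_def)
qed

lemma cmod_eigenvalue_le:
  assumes C: "C \<in> carrier_mat n n" and n: "0 < n"
    and e: "eigenvector (map_mat complex_of_real C) v e"
  shows "cmod e \<le> real_spectral_radius C"
proof -
  have "map_mat complex_of_real C \<in> carrier_mat n n" using C by simp
  moreover have "e \<in> spectrum (map_mat complex_of_real C)"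
    using e by (auto simp: spectrum_def eigenvalue_def)
  ultimately show ?thesis
    using spectral_radius_mem_max(2) n by (auto simp: real_spectral_radius_def)
qed

text \<open>An eigenvector of the scaled matrix for \<open>e\<close> is one of \<open>C\<close> for
  \<open>m * e\<close>; this is applied to an eigenvalue \<open>e\<close> of maximal
  modulus.\<close>

lemma real_spectral_radius_smult_less_one:
  assumes C: "C \<in> carrier_mat n n" and n: "0 < n"
    and m: "0 < m" "real_spectral_radius C < m"
  shows "real_spectral_radius ((1 / m) \<cdot>\<^sub>m C) < 1"
proof -
  let ?D = "(1 / m) \<cdot>\<^sub>m C"
  let ?h = "map_mat complex_of_real"
  have D: "?D \<in> carrier_mat n n" and hC: "?h C \<in> carrier_mat n n" and hD: "?h ?D \<in> carrier_mat n n"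
    using C by auto
  obtain v e where e: "eigenvector (?h ?D) v e" "cmod e = real_spectral_radius ?D"
    using real_spectral_radius_eigenvalue[OF D n] .
  have v: "v \<in> carrier_vec n" "v \<noteq> 0\<^sub>v n"
    using e(1) C by (auto simp: eigenvector_def)
  have "eigenvector (?h C) v (m * e)"
  proof (rule eigenvectorI_rows[OF hC v])
    fix i assume i: "i < n"
    have "(\<Sum>j<n. ?h C $$ (i, j) * v $ j) = of_real m * (\<Sum>j<n. ?h ?D $$ (i, j) * v $ j)"
      unfolding sum_distrib_left using C i m by (intro sum.cong) auto
    then show "(\<Sum>j<n. ?h C $$ (i, j) * v $ j) = m * e * v $ i"
      using eigenvector_row[OF hD e(1) i] by simp
  qed
  from cmod_eigenvalue_le[OF C n this] m(1) have "m * cmod e \<le> real_spectral_radius C"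
    by (simp add: norm_mult)
  also note m(2)
  finally have "m * cmod e < m * 1" by simp
  then show ?thesis using e(2) m(1) by (simp only: mult_less_cancel_left_pos)
qed

lemma subinvariant_le_spectral_radius:
  assumes C: "C \<in> carrier_mat n n" "nonneg_mat C" and n: "0 < n"
    and x: "\<And>i. i < n \<Longrightarrow> 0 < x i"
    and sub: "\<And>i. i < n \<Longrightarrow> lam * x i \<le> (\<Sum>j<n. C $$ (i, j) * x j)"
  shows "lam \<le> real_spectral_radius C"
proof (rule ccontr)
  assume "\<not> ?thesis"
  then have "real_spectral_radius C < lam" by simp
  \<comment> \<open>Dividing by a number strictly between the two values brings the spectral radius
    below one while the growth factor \<open>lam / m\<close> stays above one.\<close>
  from dense[OF this] obtain m where m: "real_spectral_radius C < m" "m < lam" by auto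
  have "0 \<le> real_spectral_radius C"
    using real_spectral_radius_eigenvalue[OF C(1) n] norm_ge_zero by metis
  with m have m0: "0 < m" by simp
  define D where "D = (1 / m) \<cdot>\<^sub>m C"
  define q where "q = lam / m"
  have q: "1 < q" using m m0 by (simp add: q_def)
  have D: "D \<in> carrier_mat n n" "nonneg_mat D"
    using C m0 by (auto simp: D_def nonneg_mat_def)
  have "spectral_radius (map_mat complex_of_real D) < 1"
    using real_spectral_radius_smult_less_one[OF C(1) n m0 m(1)]
    by (simp add: D_def real_spectral_radius_def)
  moreover have hD: "map_mat complex_of_real D \<in> carrier_mat n n" using D by simp
  \<comment> \<open>One constant bounds the entries of all powers; it is then carried over from the
    complex to the real matrix.\<close>
  ultimately obtain c where c: "\<And>k. norm_bound (map_mat complex_of_real D ^\<^sub>m k) c"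
    using spectral_radius_jnf_norm_bound_less_1_upper_triangular by blast
  have bound: "(D ^\<^sub>m k) $$ (0, j) \<le> c" if "j < n" for k j
  proof -
    have "norm ((map_mat complex_of_real D ^\<^sub>m k) $$ (0, j)) \<le> c"
      using c[of k] pow_carrier_mat[OF hD, of k] n that
      unfolding norm_bound_def by (auto simp only: carrier_matD)
    moreover have "map_mat complex_of_real D ^\<^sub>m k = map_mat complex_of_real (D ^\<^sub>m k)"
      using of_real_hom.mat_hom_pow[OF D(1)] by metis
    moreover have "map_mat complex_of_real (D ^\<^sub>m k) $$ (0, j) = of_real ((D ^\<^sub>m k) $$ (0, j))"
      using carrier_matD[OF pow_carrier_mat[OF D(1), of k]] n that by (intro index_map_mat) simp_all
    ultimately show ?thesis by simp
  qed
  have "q * x i \<le> (\<Sum>j<n. D $$ (i, j) * x j)" if "i < n" for i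
  proof -
    have "q * x i = (1 / m) * (lam * x i)" by (simp add: q_def)
    also have "\<dots> \<le> (1 / m) * (\<Sum>j<n. C $$ (i, j) * x j)"
      using sub[OF that] m0 by (intro mult_left_mono) auto
    also have "\<dots> = (\<Sum>j<n. D $$ (i, j) * x j)"
      unfolding sum_distrib_left using C that by (intro sum.cong) (auto simp: D_def)
    finally show ?thesis .
  qed
  from subinvariant_power[OF D _ this n] q
  have "q ^ k * x 0 \<le> (\<Sum>j<n. (D ^\<^sub>m k) $$ (0, j) * x j)" for k by simp
  moreover have "(\<Sum>j<n. (D ^\<^sub>m k) $$ (0, j) * x j) \<le> (\<Sum>j<n. c * x j)" for k
    using bound x by (intro sum_mono mult_right_mono) (auto intro: less_imp_le)
  ultimately have "q ^ k * x 0 \<le> (\<Sum>j<n. c * x j)" for k using order_trans by blast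
  \<comment> \<open>The right-hand side does not depend on \<open>k\<close>, whereas the powers of
    \<open>q > 1\<close> are unbounded.\<close>
  then have "q ^ k \<le> (\<Sum>j<n. c * x j) / x 0" for k
    using x[OF n] by (simp add: pos_le_divide_eq)
  with real_arch_pow[OF q] show False using not_less by blast
qed

text \<open>The upper bound compares the moduli of an eigenvector of maximal eigenvalue modulus with
  \<open>x\<close>, in a row where their ratio is largest.\<close>

lemma spectral_radius_eq_positive_eigenvector:
  assumes C: "C \<in> carrier_mat n n" "nonneg_mat C" and n: "0 < n"
    and x: "\<And>i. i < n \<Longrightarrow> 0 < x i"
    and eq: "\<And>i. i < n \<Longrightarrow> (\<Sum>j<n. C $$ (i, j) * x j) = lam * x i"
  shows "real_spectral_radius C = lam"
proof (rule antisym)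
  show "lam \<le> real_spectral_radius C"
    using subinvariant_le_spectral_radius[OF C n x] eq by simp
  let ?hC = "map_mat complex_of_real C"
  have hC: "?hC \<in> carrier_mat n n" using C by simp
  obtain v e where e: "eigenvector ?hC v e" "cmod e = real_spectral_radius C"
    using real_spectral_radius_eigenvalue[OF C(1) n] .
  have v: "v \<in> carrier_vec n" "v \<noteq> 0\<^sub>v n"
    using e(1) C by (auto simp: eigenvector_def)
  \<comment> \<open>\<open>M\<close> is the least constant with
    \<open>cmod (v $ j) \<le> M * x j\<close> for all \<open>j\<close>, and equality is attained at
    \<open>i\<close>.\<close>
  define M where "M = Max ((\<lambda>i. cmod (v $ i) / x i) ` {..<n})"
  have "M \<in> (\<lambda>i. cmod (v $ i) / x i) ` {..<n}"
    unfolding M_def using n by (intro Max_in) auto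
  then obtain i where i: "i < n" "M = cmod (v $ i) / x i" by auto
  have vM: "cmod (v $ j) \<le> M * x j" if "j < n" for j
  proof -
    have "cmod (v $ j) / x j \<le> M" unfolding M_def using that by (intro Max_ge) auto
    then show ?thesis using x[OF that] by (simp add: pos_divide_le_eq)
  qed
  have "0 < M"
  proof (rule ccontr)
    assume M: "\<not> 0 < M"
    have "v $ j = 0" if "j < n" for j
    proof -
      have "M * x j \<le> 0" using M x[OF that] by (intro mult_nonpos_nonneg) auto
      then have "cmod (v $ j) \<le> 0" using vM[OF that] by linarith
      then show ?thesis by simp
    qed
    then have "v = 0\<^sub>v n" using v(1) by (intro eq_vecI) auto
    then show False using v by simp
  qed
  have vi: "cmod (v $ i) = M * x i" using i x[OF i(1)] by simp
  have "cmod e * cmod (v $ i) = cmod (\<Sum>j<n. ?hC $$ (i, j) * v $ j)"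
    using eigenvector_row[OF hC e(1) i(1)] by (simp add: norm_mult)
  also have "\<dots> \<le> (\<Sum>j<n. C $$ (i, j) * (M * x j))"
  proof (rule order_trans[OF norm_sum], rule sum_mono)
    fix j assume "j \<in> {..<n}"
    then show "cmod (?hC $$ (i, j) * v $ j) \<le> C $$ (i, j) * (M * x j)"
      using C i(1) vM by (auto simp: norm_mult nonneg_mat_def intro!: mult_left_mono)
  qed
  also have "\<dots> = M * (\<Sum>j<n. C $$ (i, j) * x j)"
    by (simp add: sum_distrib_left mult_ac)
  also have "\<dots> = lam * cmod (v $ i)" using eq[OF i(1)] vi by simp
  finally have "cmod e * cmod (v $ i) \<le> lam * cmod (v $ i)" .
  moreover have "0 < cmod (v $ i)" unfolding vi using \<open>0 < M\<close> x[OF i(1)] by simp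
  ultimately show "real_spectral_radius C \<le> lam" using e(2) by simp
qed

section \<open>Irreducible matrices and the case of equality\<close>

text \<open>Without such an entry, listing \<open>S\<close> first and its complement afterwards
  gives a permutation that exhibits a zero lower left block.\<close>

lemma irreducible_mat_crossing_entry:
  assumes C: "C \<in> carrier_mat n n" "irreducible_mat C"
    and S: "S \<subseteq> {..<n}" "S \<noteq> {}" "S \<noteq> {..<n}"
  obtains i j where "i < n" "i \<notin> S" "j \<in> S" "C $$ (i, j) \<noteq> 0"
proof -
  have "False" if zero: "\<And>i j. i < n \<Longrightarrow> i \<notin> S \<Longrightarrow> j \<in> S \<Longrightarrow> C $$ (i, j) = 0"
  proof -
    define k where "k = card S"
    have finS: "finite S" using S(1) finite_subset by blast
    have "card S < card {..<n}" using S by (intro psubset_card_mono) auto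
    then have k: "0 < k" "k < n"
      using S(2) finS by (auto simp: k_def card_gt_0_iff)
    obtain g where g: "bij_betw g {..<k} S"
      using finite_same_card_bij[of "{..<k}" S] finS by (auto simp: k_def)
    have "card {k..<n} = card ({..<n} - S)"
      using S(1) finS by (simp add: card_Diff_subset k_def)
    then obtain h where h: "bij_betw h {k..<n} ({..<n} - S)"
      using finite_same_card_bij[of "{k..<n}" "{..<n} - S"] by auto
    \<comment> \<open>The identity beyond \<open>n\<close> is what \<open>permutes\<close> demands
      outside the index set.\<close>
    define p where "p i = (if i < k then g i else if i < n then h i else i)" for i
    have "bij_betw p {..<k} S"
      using bij_betw_cong[of "{..<k}" p g S] g by (simp add: p_def)
    moreover have "bij_betw p {k..<n} ({..<n} - S)"
      using bij_betw_cong[of "{k..<n}" p h "{..<n} - S"] h by (simp add: p_def)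
    ultimately have "bij_betw p ({..<k} \<union> {k..<n}) (S \<union> ({..<n} - S))"
      by (rule bij_betw_combine) auto
    moreover have "{..<k} \<union> {k..<n} = {..<n}" "S \<union> ({..<n} - S) = {..<n}"
      using k S by auto
    ultimately have "p permutes {..<n}"
      using k by (intro bij_imp_permutes) (auto simp: p_def)
    moreover have "C $$ (p i, p j) = 0" if "i \<in> {k..<n}" "j < k" for i j
    proof (rule zero)
      show "p i < n" "p i \<notin> S"
        using bij_betwE[OF h] that by (auto simp: p_def)
      show "p j \<in> S"
        using bij_betwE[OF g] that by (auto simp: p_def)
    qed
    ultimately have "reducible_mat C"
      using C(1) k unfolding reducible_mat_def by (auto intro!: exI[of _ p] exI[of _ k])
    then show False using C(2) by (simp add: irreducible_mat_def)
  qed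
  then show ?thesis using that by blast
qed

text \<open>With \<open>w = C x - \<lambda> x\<close>, the vector \<open>x + w / (\<lambda> + 1)\<close> is again subinvariant; by irreducibility it is
  strictly so in more rows than \<open>x\<close>, so iterating makes every row strict.\<close>

lemma strictly_subinvariant_less_spectral_radius:
  assumes C: "C \<in> carrier_mat n n" "nonneg_mat C" "irreducible_mat C" and lam: "0 \<le> lam"
    and "\<And>i. i < n \<Longrightarrow> 0 < x i"
    and "\<And>i. i < n \<Longrightarrow> lam * x i \<le> (\<Sum>j<n. C $$ (i, j) * x j)"
    and "\<exists>i<n. lam * x i < (\<Sum>j<n. C $$ (i, j) * x j)"
  shows "lam < real_spectral_radius C"
  using assms(5-)
proof (induction "card {i. i < n \<and> (\<Sum>j<n. C $$ (i, j) * x j) = lam * x i}"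
    arbitrary: x rule: less_induct)
  case (less x)
  note x = less.prems(1) and sub = less.prems(2)
  define w where "w i = (\<Sum>j<n. C $$ (i, j) * x j) - lam * x i" for i
  define S where "S = {i. i < n \<and> 0 < w i}"
  have n: "0 < n" using less.prems(3) by auto
  have w: "0 \<le> w i" if "i < n" for i using sub[OF that] by (simp add: w_def)
  have Cnn: "0 \<le> C $$ (i, j)" if "i < n" "j < n" for i j
    using C(1,2) that by (auto simp: nonneg_mat_def)
  show ?case
  proof (cases "S = {..<n}")
    case True
    \<comment> \<open>The least Collatz-Wielandt quotient of \<open>x\<close>: it exceeds
      \<open>lam\<close> because every row is strict, and \<open>x\<close> is subinvariant for
      it.\<close>
    define l where "l = Min ((\<lambda>i. (\<Sum>j<n. C $$ (i, j) * x j) / x i) ` {..<n})"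
    have "l \<in> (\<lambda>i. (\<Sum>j<n. C $$ (i, j) * x j) / x i) ` {..<n}"
      unfolding l_def using n by (intro Min_in) auto
    then obtain i where i: "i < n" "l = (\<Sum>j<n. C $$ (i, j) * x j) / x i" by auto
    then have "i \<in> S" using True by auto
    then have "lam < l" using i x[OF i(1)] by (simp add: S_def w_def pos_less_divide_eq)
    also have "l \<le> real_spectral_radius C"
    proof (rule subinvariant_le_spectral_radius[OF C(1,2) n x])
      fix i assume "i < n"
      then have "l \<le> (\<Sum>j<n. C $$ (i, j) * x j) / x i"
        unfolding l_def by (intro Min_le) auto
      then show "l * x i \<le> (\<Sum>j<n. C $$ (i, j) * x j)"
        using x[OF \<open>i < n\<close>] by (simp add: pos_le_divide_eq)
    qed
    finally show ?thesis .
  next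
    case False
    have S: "S \<subseteq> {..<n}" "S \<noteq> {}" using less.prems(3) by (auto simp: S_def w_def)
    obtain i0 j0 where ij0: "i0 < n" "i0 \<notin> S" "j0 \<in> S" "C $$ (i0, j0) \<noteq> 0"
      using irreducible_mat_crossing_entry[OF C(1,3) S False] .
    \<comment> \<open>Up to the factor \<open>1 / (lam + 1)\<close> this is \<open>x + C x\<close>.
      As \<open>C\<close> commutes with the identity plus \<open>C\<close>, the defect of
      \<open>y\<close> is \<open>w + C w\<close> up to the same factor.\<close>
    define y where "y i = x i + w i / (lam + 1)" for i
    have y: "0 < y i" if "i < n" for i
      using x[OF that] w[OF that] lam by (simp add: y_def add_pos_nonneg)
    have gap: "(\<Sum>j<n. C $$ (i, j) * y j) - lam * y i
        = (w i + (\<Sum>j<n. C $$ (i, j) * w j)) / (lam + 1)" for i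
    proof -
      have "(\<Sum>j<n. C $$ (i, j) * y j)
          = (\<Sum>j<n. C $$ (i, j) * x j) + (\<Sum>j<n. C $$ (i, j) * w j) / (lam + 1)"
        by (simp add: y_def distrib_left sum.distrib sum_divide_distrib)
      then have "(\<Sum>j<n. C $$ (i, j) * y j) - lam * y i
          = (w i - lam * (w i / (lam + 1))) + (\<Sum>j<n. C $$ (i, j) * w j) / (lam + 1)"
        by (simp add: y_def w_def distrib_left)
      also have "w i - lam * (w i / (lam + 1)) = w i / (lam + 1)"
        using lam by (simp add: field_simps)
      finally show ?thesis by (simp only: add_divide_distrib)
    qed
    have Cw: "0 \<le> (\<Sum>j<n. C $$ (i, j) * w j)" if "i < n" for i
      using Cnn[OF that] w by (intro sum_nonneg mult_nonneg_nonneg) auto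
    have ysub: "lam * y i \<le> (\<Sum>j<n. C $$ (i, j) * y j)" if "i < n" for i
    proof -
      have "0 \<le> (w i + (\<Sum>j<n. C $$ (i, j) * w j)) / (lam + 1)"
        using w[OF that] Cw[OF that] lam by simp
      then show ?thesis using gap[of i] by linarith
    qed
    have strict: "lam * y i < (\<Sum>j<n. C $$ (i, j) * y j)"
      if "i < n" "0 < w i + (\<Sum>j<n. C $$ (i, j) * w j)" for i
    proof -
      have "0 < (w i + (\<Sum>j<n. C $$ (i, j) * w j)) / (lam + 1)" using that lam by simp
      then show ?thesis using gap[of i] by linarith
    qed
    have strict_S: "lam * y i < (\<Sum>j<n. C $$ (i, j) * y j)" if "i \<in> S" for i
      using that Cw[of i] by (intro strict) (auto simp: S_def intro: add_pos_nonneg)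
    have j0: "j0 < n" "0 < w j0" using ij0(3) by (auto simp: S_def)
    \<comment> \<open>The nonzero entry passes the strictness of row \<open>j0\<close> on to row
      \<open>i0\<close>, which was tight for \<open>x\<close>.\<close>
    have "0 < C $$ (i0, j0) * w j0"
      using Cnn[OF ij0(1) j0(1)] ij0(4) j0(2) by simp
    also have "\<dots> \<le> (\<Sum>j<n. C $$ (i0, j) * w j)"
      using j0 Cnn[OF ij0(1)] w
        member_le_sum[of j0 "{..<n}" "\<lambda>j. C $$ (i0, j) * w j"] by simp
    finally have strict_i0: "lam * y i0 < (\<Sum>j<n. C $$ (i0, j) * y j)"
      using w[OF ij0(1)] by (intro strict ij0) simp
    show ?thesis
    proof (rule less.hyps[OF _ y ysub])
      have x_eq: "{i. i < n \<and> (\<Sum>j<n. C $$ (i, j) * x j) = lam * x i} = {..<n} - S"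
        using w by (auto simp: S_def w_def less_le)
      \<comment> \<open>Strict rows stay strict and \<open>i0\<close> joins them, so the number of
        tight rows drops.\<close>
      have "{i. i < n \<and> (\<Sum>j<n. C $$ (i, j) * y j) = lam * y i} \<subseteq> {..<n} - S - {i0}"
        using strict_S strict_i0 by fastforce
      also have "\<dots> \<subset> {..<n} - S" using ij0 by auto
      finally show "card {i. i < n \<and> (\<Sum>j<n. C $$ (i, j) * y j) = lam * y i}
          < card {i. i < n \<and> (\<Sum>j<n. C $$ (i, j) * x j) = lam * x i}"
        unfolding x_eq by (intro psubset_card_mono) auto
      show "\<exists>i<n. lam * y i < (\<Sum>j<n. C $$ (i, j) * y j)"
        using strict_i0 ij0(1) by blast
    qed
  qed
qed

text \<open>A single strict row would push the spectral radius above \<open>lam\<close>.\<close>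

lemma spectral_radius_eq_imp_eigenvector:
  assumes C: "C \<in> carrier_mat n n" "nonneg_mat C" "irreducible_mat C" and lam: "0 \<le> lam"
    and x: "\<And>i. i < n \<Longrightarrow> 0 < x i"
    and sub: "\<And>i. i < n \<Longrightarrow> lam * x i \<le> (\<Sum>j<n. C $$ (i, j) * x j)"
    and eq: "real_spectral_radius C = lam" and "i < n"
  shows "(\<Sum>j<n. C $$ (i, j) * x j) = lam * x i"
  using strictly_subinvariant_less_spectral_radius[OF C lam x sub] sub[OF \<open>i < n\<close>] eq \<open>i < n\<close>
  by fastforce

section \<open>The two-by-two quotient matrix\<close>

text \<open>\<open>lam\<close> is the larger root of the characteristic polynomial of the matrix
  with rows \<open>(b, g)\<close> and \<open>(a, c)\<close>. It is at least the smaller row sum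
  \<open>a + c\<close>, with equality exactly when both row sums agree.\<close>

lemma quotient_matrix_root:
  fixes a b c g :: real
  assumes "0 < a" "0 \<le> g" "a + c \<le> b + g"
  defines "lam \<equiv> (b + c + sqrt ((b - c)\<^sup>2 + 4 * g * a)) / 2"
  shows "(lam - b) * (lam - c) = g * a" "a + c \<le> lam" "lam = a + c \<longleftrightarrow> a + c = b + g"
proof -
  let ?q = "sqrt ((b - c)\<^sup>2 + 4 * g * a)"
  have disc: "0 \<le> (b - c)\<^sup>2 + 4 * g * a" using assms by simp
  have "(lam - b) * (lam - c) = (?q\<^sup>2 - (b - c)\<^sup>2) / 4"
    by (simp add: lam_def field_simps power2_eq_square)
  then show root: "(lam - b) * (lam - c) = g * a"
    using disc by simp
  \<comment> \<open>This product is the difference between the discriminant and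
    \<open>(2 * a + c - b)\<^sup>2\<close>.\<close>
  have "0 \<le> 4 * a * (b + g - (a + c))" using assms by simp
  then have "(2 * a + c - b)\<^sup>2 \<le> (b - c)\<^sup>2 + 4 * g * a"
    by (simp add: algebra_simps power2_eq_square)
  then have "2 * a + c - b \<le> ?q" by (rule real_le_rsqrt)
  then show "a + c \<le> lam" by (simp add: lam_def)
  show "lam = a + c \<longleftrightarrow> a + c = b + g"
  proof
    assume "lam = a + c"
    then show "a + c = b + g" using root assms(1) by simp
  next
    assume eq: "a + c = b + g"
    then have b: "b = a + c - g" by simp
    \<comment> \<open>Equal row sums turn the discriminant into a perfect square.\<close>
    have "(b - c)\<^sup>2 + 4 * g * a = (a + g)\<^sup>2"
      by (simp add: b algebra_simps power2_eq_square)
    then have "?q = a + g" using assms by simp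
    then show "lam = a + c" using eq by (simp add: lam_def)
  qed
qed

section \<open>The row-sum bound and its equality condition\<close>

theorem theorem10p1:
  fixes C :: "real mat" and n t :: nat and r :: "nat \<Rightarrow> real" and d f :: real
  assumes C: "C \<in> carrier_mat n n"
    and nonneg: "nonneg_mat C"
    and r: "\<And>i. i < n \<Longrightarrow> r i = row_sum C i"
    and r_decreasing: "\<And>i j. i \<le> j \<Longrightarrow> j < n \<Longrightarrow> r j \<le> r i"
    and t: "1 \<le> t" "t < n"
    and d: "d = Max {C $$ (i, i) | i. t \<le> i \<and> i < n}"
    and f: "f = Max {C $$ (i, j) | i j. i < n \<and> t \<le> j \<and> j < n \<and> i \<noteq> j}"
    and pos: "0 < r (n - 1) - (real n - real t - 1) * f - d"
    and le: "r (n - 1) - (real n - real t - 1) * f - d \<le> r (t - 1) - (real n - real t) * f"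
  shows "real_spectral_radius C \<ge>
      (r (t - 1) - f + d
        + sqrt ((r (t - 1) - (2 * real n - 2 * real t - 1) * f - d)\<^sup>2
                + 4 * (real n - real t) * f * (r (n - 1) - (real n - real t - 1) * f - d))) / 2
    \<and> (irreducible_mat C \<and> f > 0 \<longrightarrow>
        (real_spectral_radius C =
            (r (t - 1) - f + d
              + sqrt ((r (t - 1) - (2 * real n - 2 * real t - 1) * f - d)\<^sup>2
                      + 4 * (real n - real t) * f * (r (n - 1) - (real n - real t - 1) * f - d))) / 2
         \<longleftrightarrow>
         r 0 = r (n - 1) \<or>
         ((r 0 = r (t - 1) \<and> r t = r (n - 1)) \<and>
          ((\<forall>i < t. (\<Sum>j < t. C $$ (i, j)) = r (t - 1) - (real n - real t) * f) \<and>
           (\<forall>i. t \<le> i \<and> i < n \<longrightarrow>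
              (\<Sum>j < t. C $$ (i, j)) = r (n - 1) - (real n - real t - 1) * f - d)))))"
proof -
  have n: "0 < n" using t by simp
  have Cnn: "0 \<le> C $$ (i, j)" if "i < n" "j < n" for i j
    using C nonneg that by (auto simp: nonneg_mat_def)
  have "finite {C $$ (i, i) | i. t \<le> i \<and> i < n}"
    by (rule finite_subset[of _ "(\<lambda>i. C $$ (i, i)) ` {..<n}"]) auto
  then have C_le_d: "C $$ (i, i) \<le> d" if "t \<le> i" "i < n" for i
    unfolding d using that by (intro Max_ge) auto
  have "finite {C $$ (i, j) | i j. i < n \<and> t \<le> j \<and> j < n \<and> i \<noteq> j}"
    by (rule finite_subset[of _ "(\<lambda>(i, j). C $$ (i, j)) ` ({..<n} \<times> {..<n})"]) auto
  then have C_le_f: "C $$ (i, j) \<le> f" if "i < n" "t \<le> j" "j < n" "i \<noteq> j" for i j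
    unfolding f using that by (intro Max_ge) auto
  \<comment> \<open>The entry at \<open>(0, t)\<close> is off the diagonal because \<open>t\<close>
    is at least 1, so \<open>f\<close> bounds it.\<close>
  have f0: "0 \<le> f" using C_le_f[of 0 t] Cnn[of 0 t] t by simp

  define a where "a = r (n - 1) - (real n - real t - 1) * f - d"
  define b where "b = r (t - 1) - (real n - real t) * f"
  define c where "c = (real n - real t - 1) * f + d"
  define g where "g = (real n - real t) * f"
  define lam where "lam = (b + c + sqrt ((b - c)\<^sup>2 + 4 * g * a)) / 2"
  have lam_eq: "(r (t - 1) - f + d
        + sqrt ((r (t - 1) - (2 * real n - 2 * real t - 1) * f - d)\<^sup>2
                + 4 * (real n - real t) * f * (r (n - 1) - (real n - real t - 1) * f - d))) / 2 = lam"
  proof -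
    have "r (t - 1) - f + d = b + c"
      "r (t - 1) - (2 * real n - 2 * real t - 1) * f - d = b - c"
      by (simp_all add: b_def c_def algebra_simps)
    then show ?thesis by (simp add: lam_def a_def g_def mult.assoc)
  qed
  \<comment> \<open>The quotient matrix has row sums \<open>r (t - 1)\<close> and
    \<open>r (n - 1)\<close>, so the monotonicity of \<open>r\<close> orders them as the root lemma
    requires.\<close>
  have rn: "r (n - 1) = a + c" and rt: "r (t - 1) = b + g"
    by (simp_all add: a_def b_def c_def g_def)
  have a: "0 < a" and g: "0 \<le> g" using pos f0 t by (simp_all add: a_def g_def)
  have rtn: "a + c \<le> b + g"
    unfolding rn[symmetric] rt[symmetric] using t by (intro r_decreasing) auto
  note root = quotient_matrix_root[OF a g rtn, folded lam_def]
  \<comment> \<open>Chosen to solve the second eigenvector equation \<open>s * a + c = lam\<close>;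
    the first, \<open>s * b + g = lam * s\<close>, then follows from the characteristic
    equation.\<close>
  define s where "s = (lam - c) / a"
  have s1: "1 \<le> s" using root(2) a by (simp add: s_def pos_le_divide_eq)
  have lam_low: "lam = s * a + c" using a by (simp add: s_def)
  have lam_up: "lam * s = s * b + g"
  proof -
    have "(lam - b) * (lam - c) = (lam - b) * s * a" by (simp add: lam_low)
    then have "(lam - b) * s = g" using root(1) a by simp
    then show ?thesis by (simp add: algebra_simps)
  qed
  have c0: "0 \<le> c"
    using C_le_d[of t] Cnn[of t t] f0 t by (simp add: c_def)
  have lam0: "0 \<le> lam" using root(2) a c0 by simp
  have s_eq_1: "s = 1 \<longleftrightarrow> r (t - 1) = r (n - 1)"
    using root(3) a unfolding rn rt lam_low by auto

  define P where "P i = (\<Sum>j<t. C $$ (i, j))" for i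
  define Q where "Q i = (\<Sum>j=t..<n. C $$ (i, j))" for i
  have split: "(\<Sum>j<n. h j) = (\<Sum>j<t. h j) + (\<Sum>j=t..<n. h j)" for h :: "nat \<Rightarrow> real"
    using t by (simp add: lessThan_atLeast0 sum.atLeastLessThan_concat)
  have PQ: "r i = P i + Q i" if "i < n" for i
    using r[OF that] C by (simp add: row_sum_def P_def Q_def split)
  \<comment> \<open>For \<open>i < t\<close> all \<open>n - t\<close> columns of the block are off
    the diagonal; in the lower rows one of them is diagonal and is bounded by \<open>d\<close>
    instead.\<close>
  have Q_le_g: "Q i \<le> g" if "i < t" for i
  proof -
    have "Q i \<le> of_nat (card {t..<n}) * f"
      unfolding Q_def using that t by (intro sum_bounded_above C_le_f) auto
    then show ?thesis using t by (simp add: g_def of_nat_diff)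
  qed
  have Q_le_c: "Q i \<le> c" if "t \<le> i" "i < n" for i
  proof -
    have "Q i = C $$ (i, i) + (\<Sum>j\<in>{t..<n} - {i}. C $$ (i, j))"
      unfolding Q_def using that by (intro sum.remove) auto
    also have "\<dots> \<le> d + of_nat (card ({t..<n} - {i})) * f"
      using that by (intro add_mono C_le_d sum_bounded_above C_le_f) auto
    also have "\<dots> = c" using that by (simp add: c_def of_nat_diff)
    finally show ?thesis .
  qed

  define x where "x i = (if i < t then s else 1)" for i
  have x: "0 < x i" for i using s1 by (simp add: x_def)
  have Cx: "(\<Sum>j<n. C $$ (i, j) * x j) = s * P i + Q i" for i
    unfolding split P_def Q_def sum_distrib_left
    by (intro arg_cong2[of _ _ _ _ "(+)"] sum.cong) (auto simp: x_def)
  \<comment> \<open>Substituting \<open>P i = r i - Q i\<close> separates the excess of the row sum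
    from the slack in the bound on \<open>Q i\<close>, which is weighted by
    \<open>s - 1\<close>.\<close>
  have gap_up: "(\<Sum>j<n. C $$ (i, j) * x j) - lam * x i
      = s * (r i - r (t - 1)) + (s - 1) * (g - Q i)" if "i < t" for i
    using that t PQ[of i] unfolding Cx by (simp add: x_def lam_up rt[simplified] algebra_simps)
  have gap_low: "(\<Sum>j<n. C $$ (i, j) * x j) - lam * x i
      = s * (r i - r (n - 1)) + (s - 1) * (c - Q i)" if "t \<le> i" "i < n" for i
    using that PQ[of i] unfolding Cx by (simp add: x_def lam_low rn[simplified] algebra_simps)
  have r_up: "r (t - 1) \<le> r i" if "i < t" for i
    using that t by (intro r_decreasing) auto
  have r_low: "r (n - 1) \<le> r i" if "i < n" for i
    using that by (intro r_decreasing) auto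
  have sub: "lam * x i \<le> (\<Sum>j<n. C $$ (i, j) * x j)" if "i < n" for i
  proof (cases "i < t")
    case True
    then have "0 \<le> s * (r i - r (t - 1)) + (s - 1) * (g - Q i)"
      using s1 r_up Q_le_g by simp
    then show ?thesis using gap_up[OF True] by simp
  next
    case False
    then have "0 \<le> s * (r i - r (n - 1)) + (s - 1) * (c - Q i)"
      using s1 r_low Q_le_c that by simp
    then show ?thesis using gap_low[of i] False that by simp
  qed

  let ?eq = "r 0 = r (n - 1) \<or> ((r 0 = r (t - 1) \<and> r t = r (n - 1)) \<and>
      ((\<forall>i<t. P i = b) \<and> (\<forall>i. t \<le> i \<and> i < n \<longrightarrow> P i = a)))"
  have eigen_if: "(\<Sum>j<n. C $$ (i, j) * x j) = lam * x i" if ?eq "i < n" for i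
    using that(1)
  proof
    assume eq: "r 0 = r (n - 1)"
    \<comment> \<open>Equal first and last row sums squeeze all the others, and then
      \<open>s = 1\<close> removes the slack terms.\<close>
    have const: "r i = r (n - 1)" if "i < n" for i
      using r_decreasing[of 0 i] r_low[OF that] that eq by simp
    have "r (t - 1) = r (n - 1)" using t by (intro const) auto
    then have "s = 1" using s_eq_1 by simp
    then show ?thesis
      using gap_up[of i] gap_low[of i] const[OF \<open>i < n\<close>] \<open>r (t - 1) = r (n - 1)\<close> \<open>i < n\<close>
      by (cases "i < t") auto
  next
    assume eq: "(r 0 = r (t - 1) \<and> r t = r (n - 1)) \<and>
      ((\<forall>i<t. P i = b) \<and> (\<forall>i. t \<le> i \<and> i < n \<longrightarrow> P i = a))"
    show ?thesis
    proof (cases "i < t")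
      case True
      \<comment> \<open>Monotonicity squeezes \<open>r i\<close> between \<open>r 0\<close> and
        \<open>r (t - 1)\<close>; the prescribed \<open>P i\<close> then forces \<open>Q i\<close>
        to attain its bound.\<close>
      then have "r i = r (t - 1)"
        using r_decreasing[of 0 i] r_up[of i] t eq by simp
      moreover from this have "Q i = g" using PQ[of i] True eq t by (simp add: rt[simplified])
      ultimately show ?thesis using gap_up[OF True] by simp
    next
      case False
      then have "r i = r (n - 1)"
        using r_decreasing[of t i] r_low[of i] \<open>i < n\<close> eq by simp
      moreover from this have "Q i = c" using PQ[of i] False eq \<open>i < n\<close> by (simp add: rn[simplified])
      ultimately show ?thesis using gap_low[of i] False \<open>i < n\<close> by simp
    qed
  qed
  have eq_if: ?eq if eig: "\<And>i. i < n \<Longrightarrow> (\<Sum>j<n. C $$ (i, j) * x j) = lam * x i"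
  proof -
    \<comment> \<open>Both nonnegative summands of the defect vanish; as \<open>s\<close> is
      positive, the first fixes the row sum, and the second leaves two alternatives.\<close>
    have up: "r i = r (t - 1) \<and> (s = 1 \<or> Q i = g)" if "i < t" for i
    proof -
      have "s * (r i - r (t - 1)) + (s - 1) * (g - Q i) = 0"
        using gap_up[OF that] eig[of i] that t by simp
      moreover have "0 \<le> s * (r i - r (t - 1))" "0 \<le> (s - 1) * (g - Q i)"
        using s1 r_up[OF that] Q_le_g[OF that] by simp_all
      ultimately have "s * (r i - r (t - 1)) = 0" "(s - 1) * (g - Q i) = 0" by linarith+
      then show ?thesis using s1 by auto
    qed
    have low: "r i = r (n - 1) \<and> (s = 1 \<or> Q i = c)" if "t \<le> i" "i < n" for i
    proof -
      have "s * (r i - r (n - 1)) + (s - 1) * (c - Q i) = 0"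
        using gap_low[OF that] eig[of i] that by simp
      moreover have "0 \<le> s * (r i - r (n - 1))" "0 \<le> (s - 1) * (c - Q i)"
        using s1 r_low[OF that(2)] Q_le_c[OF that] by simp_all
      ultimately have "s * (r i - r (n - 1)) = 0" "(s - 1) * (c - Q i) = 0" by linarith+
      then show ?thesis using s1 by auto
    qed
    show ?thesis
    proof (cases "s = 1")
      case True
      \<comment> \<open>Here \<open>s = 1\<close> gives \<open>r (t - 1) = r (n - 1)\<close>, and
        row 0 gives \<open>r 0 = r (t - 1)\<close>, so the first alternative holds.\<close>
      then show ?thesis using up[of 0] s_eq_1 t by simp
    next
      case False
      have "P i = b" if "i < t" for i
        using up[OF that] PQ[of i] False that t by (simp add: rt[simplified])
      moreover have "P i = a" if "t \<le> i" "i < n" for i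
        using low[OF that] PQ[of i] False that by (simp add: rn[simplified])
      ultimately show ?thesis using up[of 0] low[of t] t by simp
    qed
  qed

  have "lam \<le> real_spectral_radius C"
    by (rule subinvariant_le_spectral_radius[OF C nonneg n x sub])
  moreover have "real_spectral_radius C = lam \<longleftrightarrow> ?eq" if "irreducible_mat C"
  proof
    assume "real_spectral_radius C = lam"
    then show ?eq
      using spectral_radius_eq_imp_eigenvector[OF C nonneg that lam0 x sub] by (intro eq_if)
  next
    assume ?eq
    then show "real_spectral_radius C = lam"
      using spectral_radius_eq_positive_eigenvector[OF C nonneg n x eigen_if] by blast
  qed
  ultimately show ?thesis
    unfolding lam_eq
    unfolding P_def[symmetric] a_def[symmetric] b_def[symmetric] by blast
qed

end
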